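(* Let $(X,\mathbb{A},\mu,\mathbb{S})$ be an SR-system and let $\Phi\subset\Pi(\mathbb{S})$ be a family of partitions bounding $\Pi(\mathbb{S})$ (with some rate $\varphi$). Then there is a function $q(\epsilon,l,p)$ (depending only on $\epsilon$, $l$, $p$, given the fixed SR-system and $\Phi$) such that the following holds: given a finite collection of measurable sets $\mathcal{L}\subset\mathbb{A}$, a partition $\mathcal{P}\in\Pi(\mathbb{S})$, and $\epsilon>0$, there exists $\mathcal{Q}\in\Phi$ such that (1) $\mathcal{Q}\succ\mathcal{P}$; (2) every $A\in\mathcal{L}$ is $\epsilon$-regular in $\mathcal{Q}$; (3) $|\mathcal{Q}|\leq q(\epsilon,|\mathcal{L}|,|\mathcal{P}|)$.
   Context: A measure triple $(X,\mathbb{A},\mu)$ consists of a set $X$, an algebra $\mathbb{A}\subset 2^X$ (contains $X$, closed under finite intersections, unions and differences; its elements are called measurable), and a complete, nonnegative, finitely additive measure $\mu$ on $\mathbb{A}$ with $\mu(X)=1$. A set system $\mathbb{S}$ is a semi-ring if it is closed under intersection and for all $A,B\in\mathbb{S}$ the difference $A\setminus B$ is a disjoint union of finitely many members of $\mathbb{S}$; it is $r$-built if every such difference is a disjoint union of at most $r$ members of $\mathbb{S}$, and boundedly built if it is $r$-built for some $r$. An SR-system is a quadruple $(X,\mathbb{A},\mu,\mathbb{S})$ where $(X,\mathbb{A},\mu)$ is a measure triple and $\mathbb{S}\subset\mathbb{A}$ is a boundedly built semi-ring. For $A,V\in\mathbb{A}$, $d(A,V)=\mu(A\cap V)/\mu(V)$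 if $\mu(V)>0$ and $d(A,V)=0$ otherwise. For $0<\varepsilon<1$, $V\in\mathbb{S}$ with $\mu(V)>0$, a set $A\in\mathbb{A}$ is $\varepsilon$-regular in $V$ if $|d(A,U)-d(A,V)|<\varepsilon$ for every $U\in\mathbb{S}$ with $U\subset V$ and $\mu(U)>\varepsilon\mu(V)$. For a partition $\mathcal{P}$ of $X$ into members of $\mathbb{S}$, $A\in\mathbb{A}$ is $\varepsilon$-regular in $\mathcal{P}$ if $\sum\{\mu(P):P\in\mathcal{P},\ A \text{ is not } \varepsilon\text{-regular in } P\}<\varepsilon$. $\Pi(\mathbb{X})$ denotes the family of finite partitions of $X$ into sets belonging to $\mathbb{X}$. For partitions $\mathcal{P},\mathcal{Q}$ of $X$, $\mathcal{Q}\succ\mathcal{P}$ ($\mathcal{Q}$ refines $\mathcal{P}$) means every member of $\mathcal{P}$ is a union of members of $\mathcal{Q}$. A family $\Phi\subset\Pi(\mathbb{S})$ bounds $\Pi(\mathbb{S})$ with rate $\varphi$, where $\varphi:\mathbb{N}\to\mathbb{N}$ is a fixed increasing function, if for every $\mathcal{P}\in\Pi(\mathbb{S})$ there exists $\mathcal{Q}\in\Phi$ with $\mathcal{Q}\succ\mathcal{P}$ and $|\mathcal{Q}|\le\varphi(|\mathcal{P}|)$. *)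

theory Defs
  imports "HOL-Analysis.Analysis"
begin

locale measure_triple = algebra X \<A>
  for X :: "'a set" and \<A> :: "'a set set" +
  fixes \<mu> :: "'a set \<Rightarrow> real"
  assumes nonneg: "\<And>A. A \<in> \<A> \<Longrightarrow> 0 \<le> \<mu> A"
    and finitely_additive: "Measure_Space.additive \<A> \<mu>"
    and complete: "\<And>N B. N \<in> \<A> \<Longrightarrow> \<mu> N = 0 \<Longrightarrow> B \<subseteq> N \<Longrightarrow> B \<in> \<A>"
    and measure_space_1: "\<mu> X = 1"

text \<open>Unlike \<^const>\<open>semiring_of_sets\<close>, the empty set is not required to be a member.\<close>

definition semi_ring :: "'a set set \<Rightarrow> bool" where
  "semi_ring \<S> \<longleftrightarrow>
     (\<forall>A\<in>\<S>. \<forall>B\<in>\<S>. A \<inter> B \<in> \<S>) \<and>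
     (\<forall>A\<in>\<S>. \<forall>B\<in>\<S>. \<exists>\<C>\<subseteq>\<S>. finite \<C> \<and> disjoint \<C> \<and> A - B = \<Union>\<C>)"

definition built :: "nat \<Rightarrow> 'a set set \<Rightarrow> bool" where
  "built r \<S> \<longleftrightarrow>
     (\<forall>A\<in>\<S>. \<forall>B\<in>\<S>. \<exists>\<C>\<subseteq>\<S>. finite \<C> \<and> card \<C> \<le> r \<and> disjoint \<C> \<and> A - B = \<Union>\<C>)"

definition boundedly_built :: "'a set set \<Rightarrow> bool" where
  "boundedly_built \<S> \<longleftrightarrow> (\<exists>r. built r \<S>)"

locale SR_system = measure_triple X \<A> \<mu>
  for X :: "'a set" and \<A> :: "'a set set" and \<mu> :: "'a set \<Rightarrow> real" +
  fixes \<S> :: "'a set set"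
  assumes members_measurable: "\<S> \<subseteq> \<A>"
    and semi_ring: "semi_ring \<S>"
    and boundedly_built: "boundedly_built \<S>"

definition rel_density :: "('a set \<Rightarrow> real) \<Rightarrow> 'a set \<Rightarrow> 'a set \<Rightarrow> real" where
  "rel_density \<mu> A V = (if \<mu> V > 0 then \<mu> (A \<inter> V) / \<mu> V else 0)"

text \<open>The notion is meant for \<open>\<mu> V > 0\<close>. A null set \<open>V\<close> satisfies it vacuously, which is
  immaterial below, where a null part contributes \<open>0\<close> to the sum in either case.\<close>

definition regular_in_set ::
  "('a set \<Rightarrow> real) \<Rightarrow> 'a set set \<Rightarrow> real \<Rightarrow> 'a set \<Rightarrow> 'a set \<Rightarrow> bool" where
  "regular_in_set \<mu> \<S> \<epsilon> A V \<longleftrightarrow>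
     (\<forall>U\<in>\<S>. U \<subseteq> V \<and> \<mu> U > \<epsilon> * \<mu> V \<longrightarrow> \<bar>rel_density \<mu> A U - rel_density \<mu> A V\<bar> < \<epsilon>)"

definition regular_in_partition ::
  "('a set \<Rightarrow> real) \<Rightarrow> 'a set set \<Rightarrow> real \<Rightarrow> 'a set \<Rightarrow> 'a set set \<Rightarrow> bool" where
  "regular_in_partition \<mu> \<S> \<epsilon> A \<P> \<longleftrightarrow>
     (\<Sum>P | P \<in> \<P> \<and> \<not> regular_in_set \<mu> \<S> \<epsilon> A P. \<mu> P) < \<epsilon>"

definition finite_partitions :: "'a set \<Rightarrow> 'a set set \<Rightarrow> 'a set set set" where
  "finite_partitions X \<X> = {\<P>. finite \<P> \<and> \<P> \<subseteq> \<X> \<and> partition_on X \<P>}"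

definition finer :: "'a set set \<Rightarrow> 'a set set \<Rightarrow> bool" (infix "\<succ>" 50) where
  "\<Q> \<succ> \<P> \<longleftrightarrow> (\<forall>P\<in>\<P>. \<exists>\<R>\<subseteq>\<Q>. P = \<Union>\<R>)"

definition bounds_with_rate ::
  "'a set \<Rightarrow> 'a set set \<Rightarrow> 'a set set set \<Rightarrow> (nat \<Rightarrow> nat) \<Rightarrow> bool" where
  "bounds_with_rate X \<S> \<Phi> \<phi> \<longleftrightarrow>
     \<Phi> \<subseteq> finite_partitions X \<S> \<and> mono \<phi> \<and>
     (\<forall>\<P>\<in>finite_partitions X \<S>. \<exists>\<Q>\<in>\<Phi>. \<Q> \<succ> \<P> \<and> card \<Q> \<le> \<phi> (card \<P>))"

end

theory Submission
  imports Defs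
begin

text \<open>The energy of a partition with respect to \<open>A\<close> is \<open>\<Sum>P. d(A,P)\<^sup>2 \<mu>(P)\<close>. It lies between 0
  and 1 and does not decrease under refinement. If \<open>A\<close> is not \<open>\<epsilon>\<close>-regular in a partition, cutting
  each irregular part \<open>P\<close> along a witness \<open>U\<close> gains \<open>\<epsilon>\<^sup>2 \<mu>(U) \<ge> \<epsilon>\<^sup>3 \<mu>(P)\<close>, hence at least \<open>\<epsilon>\<^sup>4\<close> in
  total, while the number of parts grows by a factor of at most \<open>r + 1\<close>. Passing to a member of
  \<open>\<Phi>\<close> after each cut, all sets of \<open>\<L>\<close> become regular after at most \<open>\<bar>\<L>\<bar> / \<epsilon>\<^sup>4\<close> rounds.\<close>

section \<open>Refinement, and partitions glued from partitions of the parts\<close>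

lemma partition_on_UN_partitions:
  assumes "partition_on X \<P>" "\<And>P. P \<in> \<P> \<Longrightarrow> partition_on P (C P)"
  shows "partition_on X (\<Union>(C ` \<P>))"
proof (rule partition_onI)
  show "\<Union> (\<Union> (C ` \<P>)) = X"
    using assms unfolding partition_on_def by fastforce
  show "{} \<notin> \<Union> (C ` \<P>)"
    using assms unfolding partition_on_def by fastforce
next
  fix p p' assume "p \<in> \<Union> (C ` \<P>)" "p' \<in> \<Union> (C ` \<P>)" "p \<noteq> p'"
  then obtain P P' where P: "P \<in> \<P>" "p \<in> C P" "P' \<in> \<P>" "p' \<in> C P'" by blast
  have sub: "p \<subseteq> P" "p' \<subseteq> P'"
    using assms(2) P unfolding partition_on_def by blast+
  show "disjnt p p'"
  proof (cases "P = P'")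
    case True
    then show ?thesis
      using assms(2)[OF P(1)] P \<open>p \<noteq> p'\<close>
      unfolding partition_on_def disjnt_def disjoint_def by blast
  next
    case False
    then have "P \<inter> P' = {}"
      using assms(1) P unfolding partition_on_def disjoint_def by blast
    then show ?thesis using sub unfolding disjnt_def by blast
  qed
qed

text \<open>The parts of \<open>\<Q>\<close> contained in \<open>P\<close> form the largest
  candidate for the subfamily with union \<open>P\<close>. The pointwise form makes transitivity a
  matter of chaining inclusions.\<close>

lemma finer_iff: "\<Q> \<succ> \<P> \<longleftrightarrow> (\<forall>P\<in>\<P>. \<forall>x\<in>P. \<exists>Q\<in>\<Q>. x \<in> Q \<and> Q \<subseteq> P)"
  unfolding finer_def
proof (intro iffI ballI)
  fix P x assume "\<forall>P\<in>\<P>. \<exists>\<R>\<subseteq>\<Q>. P = \<Union>\<R>" "P \<in> \<P>" "x \<in> P"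
  then obtain \<R> where "\<R> \<subseteq> \<Q>" "P = \<Union>\<R>" by meson
  with \<open>x \<in> P\<close> show "\<exists>Q\<in>\<Q>. x \<in> Q \<and> Q \<subseteq> P" by blast
next
  fix P assume "\<forall>P\<in>\<P>. \<forall>x\<in>P. \<exists>Q\<in>\<Q>. x \<in> Q \<and> Q \<subseteq> P" "P \<in> \<P>"
  then show "\<exists>\<R>\<subseteq>\<Q>. P = \<Union>\<R>"
    by (intro exI[of _ "{Q\<in>\<Q>. Q \<subseteq> P}"]) fastforce
qed

lemma finer_trans: "\<R> \<succ> \<Q> \<Longrightarrow> \<Q> \<succ> \<P> \<Longrightarrow> \<R> \<succ> \<P>"
  unfolding finer_iff by (meson subset_trans)

lemma finer_refl: "\<P> \<succ> \<P>"
  unfolding finer_iff by blast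

lemma finer_UN_partitions:
  assumes "\<And>P. P \<in> \<P> \<Longrightarrow> partition_on P (C P)"
  shows "\<Union>(C ` \<P>) \<succ> \<P>"
  unfolding finer_def
proof
  fix P assume "P \<in> \<P>"
  then show "\<exists>\<R>\<subseteq>\<Union>(C ` \<P>). P = \<Union>\<R>"
    using assms by (intro exI[of _ "C P"]) (auto simp: partition_on_def)
qed

text \<open>A common member would lie in \<open>P \<inter> P'\<close> and, as a part of a partition,
  be nonempty. Hence sums over glued partitions involve no double counting.\<close>

lemma disjoint_parts_of_disjoint:
  assumes "P \<inter> P' = {}" "partition_on P \<C>" "partition_on P' \<C>'"
  shows "\<C> \<inter> \<C>' = {}"
proof (rule equals0I)
  fix V assume V: "V \<in> \<C> \<inter> \<C>'"
  then have "V \<subseteq> P" "V \<subseteq> P'" "V \<noteq> {}"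
    using assms(2,3) by (auto simp: partition_on_def)
  then show False using assms(1) by blast
qed

lemma sum_UN_partitions:
  assumes "finite \<P>" "partition_on X \<P>"
    and "\<And>P. P \<in> \<P> \<Longrightarrow> finite (C P)" "\<And>P. P \<in> \<P> \<Longrightarrow> partition_on P (C P)"
  shows "sum f (\<Union>(C ` \<P>)) = (\<Sum>P\<in>\<P>. sum f (C P))"
proof (rule sum.UNION_disjoint)
  show "\<forall>i\<in>\<P>. \<forall>j\<in>\<P>. i \<noteq> j \<longrightarrow> C i \<inter> C j = {}"
    using assms(2,4) by (meson disjoint_parts_of_disjoint disjointD partition_onD2)
qed (use assms in auto)

section \<open>Energy and the gain from one cut\<close>

text \<open>For \<open>\<mu> V > 0\<close> this is the squared relative density weighted by
  \<open>\<mu> V\<close>; for a null set, division by zero gives the desired value 0.\<close>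

definition set_energy :: "('a set \<Rightarrow> real) \<Rightarrow> 'a set \<Rightarrow> 'a set \<Rightarrow> real" where
  "set_energy \<mu> A V = (\<mu> (A \<inter> V))\<^sup>2 / \<mu> V"

definition energy :: "('a set \<Rightarrow> real) \<Rightarrow> 'a set \<Rightarrow> 'a set set \<Rightarrow> real" where
  "energy \<mu> A \<P> = (\<Sum>P\<in>\<P>. set_energy \<mu> A P)"

text \<open>A two-point variance identity: for \<open>w > 0\<close> the increase in energy is
  exactly \<open>u * (u + w) / w\<close> times the squared deviation of \<open>a / u\<close> from
  the overall density, and \<open>(u + w) / w\<close> is at least 1. If \<open>w = 0\<close> then
  \<open>b = 0\<close> and both sides equal \<open>a\<^sup>2 / u\<close>.\<close>

lemma energy_split_gain:
  fixes a b u w :: real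
  assumes "0 < u" "0 \<le> w" "0 \<le> b" "b \<le> w"
  shows "(a + b)\<^sup>2 / (u + w) + u * (a / u - (a + b) / (u + w))\<^sup>2 \<le> a\<^sup>2 / u + b\<^sup>2 / w"
proof (cases "w = 0")
  case True
  then show ?thesis using assms by simp
next
  case False
  then have w: "0 < w" using assms by simp
  define D where "D = a / u - (a + b) / (u + w)"
  have D: "D = (a * w - b * u) / (u * (u + w))"
    using w assms unfolding D_def by (simp add: field_simps)
  have "a\<^sup>2 / u + b\<^sup>2 / w - (a + b)\<^sup>2 / (u + w) = (a * w - b * u)\<^sup>2 / (u * w * (u + w))"
  proof -
    have "a\<^sup>2 / u + b\<^sup>2 / w - (a + b)\<^sup>2 / (u + w) =
        (a\<^sup>2 * w * (u + w) + b\<^sup>2 * u * (u + w) - (a + b)\<^sup>2 * u * w) / (u * w * (u + w))"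
      using w assms by (simp add: field_simps add_pos_pos)
    also have "a\<^sup>2 * w * (u + w) + b\<^sup>2 * u * (u + w) - (a + b)\<^sup>2 * u * w = (a * w - b * u)\<^sup>2"
      by algebra
    finally show ?thesis .
  qed
  also have "\<dots> = u * (u + w) / w * D\<^sup>2"
  proof -
    have "u + w \<noteq> 0" using w assms by simp
    then show ?thesis using w assms unfolding D power_divide power_mult_distrib
      by (simp add: power2_eq_square divide_simps mult.assoc)
  qed
  also have "\<dots> \<ge> u * D\<^sup>2"
    using w assms by (intro mult_right_mono) (auto simp: field_simps)
  finally show ?thesis unfolding D_def by linarith
qed

section \<open>Energy under a finitely additive measure\<close>

context measure_triple
begin

lemma measure_empty: "\<mu> {} = 0"
  using additiveD[OF finitely_additive, of "{}" "{}"] by simp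

lemma measure_Un_disjoint: "A \<in> \<A> \<Longrightarrow> B \<in> \<A> \<Longrightarrow> A \<inter> B = {} \<Longrightarrow> \<mu> (A \<union> B) = \<mu> A + \<mu> B"
  using additiveD[OF finitely_additive] by simp

lemma measure_mono: "A \<in> \<A> \<Longrightarrow> B \<in> \<A> \<Longrightarrow> A \<subseteq> B \<Longrightarrow> \<mu> A \<le> \<mu> B"
  using measure_Un_disjoint[of A "B - A"] nonneg[of "B - A"] Diff[of B A] by (simp add: Un_absorb1)

lemma measure_Union_disjoint:
  assumes "finite \<C>" "\<C> \<subseteq> \<A>" "disjoint \<C>"
  shows "\<mu> (\<Union>\<C>) = (\<Sum>V\<in>\<C>. \<mu> V)"
  using assms
proof (induction \<C>)
  case (insert V \<C>)
  then have "V \<inter> \<Union>\<C> = {}" by (auto simp: disjoint_def)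
  moreover have "\<Union>\<C> \<in> \<A>" using insert by (intro finite_Union) auto
  ultimately show ?case using insert by (simp add: measure_Un_disjoint disjoint_def)
qed (simp add: measure_empty)

lemma set_energy_nonneg: "V \<in> \<A> \<Longrightarrow> 0 \<le> set_energy \<mu> A V"
  unfolding set_energy_def by (simp add: nonneg)

lemma set_energy_le: "A \<in> \<A> \<Longrightarrow> V \<in> \<A> \<Longrightarrow> set_energy \<mu> A V \<le> \<mu> V"
proof -
  assume *: "A \<in> \<A>" "V \<in> \<A>"
  have "\<mu> (A \<inter> V) \<le> \<mu> V" "0 \<le> \<mu> (A \<inter> V)" using * by (auto intro: measure_mono nonneg)
  then have "(\<mu> (A \<inter> V))\<^sup>2 \<le> \<mu> V * \<mu> V"
    unfolding power2_eq_square by (intro mult_mono) auto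
  then show ?thesis using nonneg[OF *(2)] unfolding set_energy_def
    by (cases "\<mu> V = 0") (auto simp: field_simps)
qed

lemma set_energy_split:
  assumes A: "A \<in> \<A>" and UW: "U \<in> \<A>" "W \<in> \<A>" "U \<inter> W = {}" and pos: "0 < \<mu> U"
  shows "set_energy \<mu> A (U \<union> W) + \<mu> U * (rel_density \<mu> A U - rel_density \<mu> A (U \<union> W))\<^sup>2
    \<le> set_energy \<mu> A U + set_energy \<mu> A W"
proof -
  have "\<mu> (A \<inter> (U \<union> W)) = \<mu> (A \<inter> U) + \<mu> (A \<inter> W)"
    using measure_Un_disjoint[of "A \<inter> U" "A \<inter> W"] assms by (auto simp: Int_Un_distrib)
  moreover have "\<mu> (U \<union> W) = \<mu> U + \<mu> W" using UW by (rule measure_Un_disjoint)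
  moreover have "0 \<le> \<mu> W" "0 \<le> \<mu> (A \<inter> W)" "\<mu> (A \<inter> W) \<le> \<mu> W"
    using assms by (auto intro: nonneg measure_mono)
  ultimately show ?thesis
    using energy_split_gain[OF pos] pos
    unfolding set_energy_def rel_density_def by (simp add: add_pos_nonneg)
qed

lemma set_energy_Un_le:
  assumes "A \<in> \<A>" "U \<in> \<A>" "W \<in> \<A>" "U \<inter> W = {}"
  shows "set_energy \<mu> A (U \<union> W) \<le> set_energy \<mu> A U + set_energy \<mu> A W"
\<comment> \<open>The splitting inequality needs \<open>\<mu> U > 0\<close>; a null \<open>U\<close>
  changes neither \<open>\<mu> (A \<inter> W)\<close> nor \<open>\<mu> W\<close>, so equality holds
  there.\<close>
proof (cases "\<mu> U = 0")
  case True
  then have "\<mu> (A \<inter> U) = 0"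
    using measure_mono[of "A \<inter> U" U] nonneg[of "A \<inter> U"] True Int[of A U] assms by auto
  moreover have "\<mu> (A \<inter> (U \<union> W)) = \<mu> (A \<inter> U) + \<mu> (A \<inter> W)"
    using measure_Un_disjoint[of "A \<inter> U" "A \<inter> W"] assms by (auto simp: Int_Un_distrib)
  ultimately show ?thesis
    using True measure_Un_disjoint[of U W] assms by (simp add: set_energy_def)
next
  case False
  then have "0 < \<mu> U" using nonneg assms by (simp add: order_less_le)
  then have "0 \<le> \<mu> U * (rel_density \<mu> A U - rel_density \<mu> A (U \<union> W))\<^sup>2" by simp
  with set_energy_split[OF assms \<open>0 < \<mu> U\<close>] show ?thesis by linarith
qed

lemma set_energy_Union_le:
  assumes "A \<in> \<A>" "finite \<C>" "\<C> \<subseteq> \<A>" "disjoint \<C>"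
  shows "set_energy \<mu> A (\<Union>\<C>) \<le> energy \<mu> A \<C>"
  using assms(2-)
proof (induction \<C>)
  case empty
  then show ?case by (simp add: set_energy_def energy_def measure_empty)
next
  case (insert V \<C>)
  then have "V \<inter> \<Union>\<C> = {}" by (auto simp: disjoint_def)
  moreover have "\<Union>\<C> \<in> \<A>" using insert by (intro finite_Union) auto
  ultimately have "set_energy \<mu> A (V \<union> \<Union>\<C>) \<le> set_energy \<mu> A V + set_energy \<mu> A (\<Union>\<C>)"
    using set_energy_Un_le[of A V "\<Union>\<C>"] assms(1) insert by simp
  moreover have "set_energy \<mu> A (\<Union>\<C>) \<le> energy \<mu> A \<C>"
    using insert by (simp add: disjoint_def)
  ultimately show ?case using insert by (simp add: energy_def)
qed

text \<open>Each part contributes at most its measure, and these measures sum to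
  \<open>\<mu> X\<close>.\<close>

lemma energy_le_1:
  assumes "A \<in> \<A>" "\<P> \<in> finite_partitions X \<A>"
  shows "energy \<mu> A \<P> \<le> 1"
proof -
  have "energy \<mu> A \<P> \<le> (\<Sum>P\<in>\<P>. \<mu> P)"
    unfolding energy_def using assms
    by (intro sum_mono set_energy_le) (auto simp: finite_partitions_def)
  also have "\<dots> = \<mu> (\<Union>\<P>)"
    using assms by (intro measure_Union_disjoint[symmetric])
      (auto simp: finite_partitions_def partition_on_def)
  also have "\<dots> = 1"
    using assms measure_space_1 by (simp add: finite_partitions_def partition_on_def)
  finally show ?thesis .
qed

lemma energy_finer_mono:
  assumes A: "A \<in> \<A>" and P: "\<P> \<in> finite_partitions X \<A>" and Q: "\<Q> \<in> finite_partitions X \<A>"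
    and "\<Q> \<succ> \<P>"
  shows "energy \<mu> A \<P> \<le> energy \<mu> A \<Q>"
proof -
  \<comment> \<open>Group the parts of \<open>\<Q>\<close> by the part of \<open>\<P>\<close>
    containing them. Refinement makes each group cover its \<open>P\<close>; disjointness is
    inherited from \<open>\<Q>\<close>.\<close>
  define C where "C P = {Q\<in>\<Q>. Q \<subseteq> P}" for P
  have C: "partition_on P (C P)" "finite (C P)" "C P \<subseteq> \<A>" if "P \<in> \<P>" for P
  proof -
    have "\<Union>(C P) = P" using that \<open>\<Q> \<succ> \<P>\<close> unfolding finer_iff C_def by fastforce
    then show "partition_on P (C P)" "finite (C P)" "C P \<subseteq> \<A>"
      using Q unfolding C_def finite_partitions_def partition_on_def disjoint_def by auto
  qed
  have "energy \<mu> A \<P> \<le> (\<Sum>P\<in>\<P>. energy \<mu> A (C P))"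
    unfolding energy_def[of \<mu> A \<P>]
  proof (rule sum_mono)
    fix P assume "P \<in> \<P>"
    then show "set_energy \<mu> A P \<le> energy \<mu> A (C P)"
      using set_energy_Union_le[OF A, of "C P"] C[of P] by (simp add: partition_on_def)
  qed
  also have "\<dots> = energy \<mu> A (\<Union>(C ` \<P>))"
    unfolding energy_def using P C
    by (intro sum_UN_partitions[symmetric]) (auto simp: finite_partitions_def)
  \<comment> \<open>Every grouped part belongs to \<open>\<Q>\<close>; since energies are
    nonnegative, this inclusion is enough.\<close>
  also have "\<dots> \<le> energy \<mu> A \<Q>"
    unfolding energy_def using Q
    by (intro sum_mono2 set_energy_nonneg) (auto simp: C_def finite_partitions_def)
  finally show ?thesis .
qed

end

section \<open>Energy increment by cutting irregular parts, and its iteration\<close>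

context SR_system
begin

lemma finite_partitions_measurable: "finite_partitions X \<S> \<subseteq> finite_partitions X \<A>"
  using members_measurable by (auto simp: finite_partitions_def)

text \<open>The new parts are a witness \<open>U\<close> of irregularity and the at most
  \<open>r\<close> pieces of \<open>V - U\<close>. Splitting off \<open>U\<close> produces the gain;
  cutting up \<open>V - U\<close> loses nothing.\<close>

lemma refine_irregular_set:
  assumes r: "built r \<S>" and A: "A \<in> \<A>" and V: "V \<in> \<S>" and "0 < \<epsilon>"
    and irr: "\<not> regular_in_set \<mu> \<S> \<epsilon> A V"
  shows "\<exists>\<C>\<subseteq>\<S>. finite \<C> \<and> card \<C> \<le> r + 1 \<and> partition_on V \<C> \<and>
    set_energy \<mu> A V + \<epsilon> ^ 3 * \<mu> V \<le> energy \<mu> A \<C>"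
proof -
  obtain U where U: "U \<in> \<S>" "U \<subseteq> V" "\<mu> U > \<epsilon> * \<mu> V"
    and dev: "\<epsilon> \<le> \<bar>rel_density \<mu> A U - rel_density \<mu> A V\<bar>"
    using irr unfolding regular_in_set_def by (auto simp: not_less)
  have meas: "U \<in> \<A>" "V \<in> \<A>" using U V members_measurable by auto
  have "0 \<le> \<epsilon> * \<mu> V" using \<open>0 < \<epsilon>\<close> nonneg[OF meas(2)] by simp
  then have pos: "0 < \<mu> U" using U by linarith
  then have "U \<noteq> {}" using measure_empty by auto
  obtain \<D> where \<D>: "\<D> \<subseteq> \<S>" "finite \<D>" "card \<D> \<le> r" "disjoint \<D>" "V - U = \<Union>\<D>"
    using r V U(1) unfolding built_def by meson
  \<comment> \<open>The decomposition of \<open>V - U\<close> may contain the empty set, which a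
    partition must not.\<close>
  define \<E> where "\<E> = \<D> - {{}}"
  have \<E>: "\<E> \<subseteq> \<S>" "finite \<E>" "disjoint \<E>" "V - U = \<Union>\<E>" "{} \<notin> \<E>"
    using \<D>(1,2,4,5) unfolding \<E>_def disjoint_def by auto
  have card_\<E>: "card \<E> \<le> r"
    using card_mono[of \<D> \<E>] \<D>(2,3) unfolding \<E>_def by (simp add: subset_iff)
  have "U \<notin> \<E>" using \<E>(4) \<open>U \<noteq> {}\<close> by blast
  \<comment> \<open>One factor \<open>\<epsilon>\<close> comes from the size of \<open>U\<close>,
    two from the squared density deviation.\<close>
  have "\<epsilon> ^ 3 * \<mu> V = (\<epsilon> * \<mu> V) * \<epsilon>\<^sup>2" by (simp add: power3_eq_cube power2_eq_square)
  also have "\<dots> \<le> \<mu> U * (rel_density \<mu> A U - rel_density \<mu> A V)\<^sup>2"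
  proof (rule mult_mono)
    show "\<epsilon>\<^sup>2 \<le> (rel_density \<mu> A U - rel_density \<mu> A V)\<^sup>2"
      using dev \<open>0 < \<epsilon>\<close> by (simp add: abs_le_square_iff[symmetric])
  qed (use U pos in auto)
  finally have gain: "\<epsilon> ^ 3 * \<mu> V \<le> \<mu> U * (rel_density \<mu> A U - rel_density \<mu> A V)\<^sup>2" .
  have "U \<union> (V - U) = V" using U by blast
  then have "set_energy \<mu> A V + \<epsilon> ^ 3 * \<mu> V \<le> set_energy \<mu> A U + set_energy \<mu> A (V - U)"
    using set_energy_split[OF A meas(1), of "V - U"] meas pos gain Diff[of V U] by auto
  also have "set_energy \<mu> A (V - U) \<le> energy \<mu> A \<E>"
    using set_energy_Union_le[OF A, of \<E>] \<E> members_measurable by auto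
  also have "set_energy \<mu> A U + energy \<mu> A \<E> = energy \<mu> A (insert U \<E>)"
    using \<open>U \<notin> \<E>\<close> \<E> by (simp add: energy_def)
  finally have "set_energy \<mu> A V + \<epsilon> ^ 3 * \<mu> V \<le> energy \<mu> A (insert U \<E>)" by simp
  moreover have "partition_on V (insert U \<E>)"
    using \<E>(3-5) U(2) \<open>U \<noteq> {}\<close> unfolding partition_on_def disjoint_def by auto
  ultimately show ?thesis
    using \<E>(1,2) card_\<E> U(1) by (intro exI[of _ "insert U \<E>"]) (auto simp: card_insert_if)
qed

lemma refine_irregular_partition:
  assumes r: "built r \<S>" and A: "A \<in> \<A>" and P: "\<P> \<in> finite_partitions X \<S>" and "0 < \<epsilon>"
    and irr: "\<not> regular_in_partition \<mu> \<S> \<epsilon> A \<P>"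
  shows "\<exists>\<Q>\<in>finite_partitions X \<S>. \<Q> \<succ> \<P> \<and> card \<Q> \<le> (r + 1) * card \<P> \<and>
    energy \<mu> A \<P> + \<epsilon> ^ 4 \<le> energy \<mu> A \<Q>"
proof -
  define irregular where "irregular P \<longleftrightarrow> \<not> regular_in_set \<mu> \<S> \<epsilon> A P" for P
  define gain where "gain P = (if irregular P then \<epsilon> ^ 3 * \<mu> P else 0)" for P
  have fin: "finite \<P>" and part: "partition_on X \<P>" and sub: "\<P> \<subseteq> \<S>"
    using P by (auto simp: finite_partitions_def)
  have "\<exists>\<C>\<subseteq>\<S>. finite \<C> \<and> card \<C> \<le> r + 1 \<and> partition_on P \<C> \<and>
      set_energy \<mu> A P + gain P \<le> energy \<mu> A \<C>" if "P \<in> \<P>" for P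
  proof (cases "irregular P")
    case True
    then show ?thesis
      using refine_irregular_set[OF r A _ \<open>0 < \<epsilon>\<close>, of P] that sub
      unfolding irregular_def gain_def by auto
  next
    case False
    \<comment> \<open>A regular part is kept whole, with partition \<open>{P}\<close> and gain
      0.\<close>
    have "P \<noteq> {}" using part that by (auto simp: partition_on_def)
    with False show ?thesis using that sub
      by (intro exI[of _ "{P}"]) (auto simp: gain_def energy_def partition_on_def)
  qed
  then obtain C where C: "\<And>P. P \<in> \<P> \<Longrightarrow> C P \<subseteq> \<S>" "\<And>P. P \<in> \<P> \<Longrightarrow> finite (C P)"
    "\<And>P. P \<in> \<P> \<Longrightarrow> card (C P) \<le> r + 1" "\<And>P. P \<in> \<P> \<Longrightarrow> partition_on P (C P)"
    "\<And>P. P \<in> \<P> \<Longrightarrow> set_energy \<mu> A P + gain P \<le> energy \<mu> A (C P)"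
    by metis
  define \<Q> where "\<Q> = \<Union>(C ` \<P>)"
  \<comment> \<open>The fourth factor \<open>\<epsilon>\<close>: the irregular parts have total
    measure at least \<open>\<epsilon>\<close>.\<close>
  have "\<epsilon> \<le> (\<Sum>P | P \<in> \<P> \<and> irregular P. \<mu> P)"
    using irr unfolding regular_in_partition_def irregular_def by simp
  then have "\<epsilon> ^ 3 * \<epsilon> \<le> \<epsilon> ^ 3 * (\<Sum>P | P \<in> \<P> \<and> irregular P. \<mu> P)"
    using \<open>0 < \<epsilon>\<close> by (intro mult_left_mono) auto
  also have "\<dots> = (\<Sum>P\<in>\<P>. gain P)"
    unfolding gain_def sum_distrib_left using fin by (simp add: sum.inter_filter)
  finally have "energy \<mu> A \<P> + \<epsilon> ^ 4 \<le> (\<Sum>P\<in>\<P>. set_energy \<mu> A P + gain P)"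
    by (simp add: energy_def sum.distrib power3_eq_cube power4_eq_xxxx)
  also have "\<dots> \<le> (\<Sum>P\<in>\<P>. energy \<mu> A (C P))" by (intro sum_mono C)
  also have "\<dots> = energy \<mu> A \<Q>"
    unfolding energy_def \<Q>_def using fin part C by (intro sum_UN_partitions[symmetric]) auto
  finally have "energy \<mu> A \<P> + \<epsilon> ^ 4 \<le> energy \<mu> A \<Q>" .
  moreover have "card \<Q> \<le> (r + 1) * card \<P>"
  proof -
    have "card \<Q> \<le> (\<Sum>P\<in>\<P>. card (C P))" unfolding \<Q>_def by (rule card_UN_le[OF fin])
    also have "\<dots> \<le> (\<Sum>P\<in>\<P>. r + 1)" by (intro sum_mono C)
    finally show ?thesis by (simp add: mult.commute)
  qed
  moreover have "\<Q> \<in> finite_partitions X \<S>"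
    unfolding finite_partitions_def \<Q>_def
    using fin C partition_on_UN_partitions[OF part C(4)] by auto
  moreover have "\<Q> \<succ> \<P>" unfolding \<Q>_def using C(4) by (rule finer_UN_partitions)
  ultimately show ?thesis by blast
qed

text \<open>Induction on the number \<open>n\<close> of rounds left. The total energy never exceeds
  \<open>card \<L>\<close>, so the last hypothesis says that \<open>n\<close> gains of
  \<open>\<epsilon> ^ 4\<close> would be too many. In one round, cutting multiplies the number of
  parts by at most \<open>r + 1\<close> and the return to \<open>\<Phi>\<close> applies
  \<open>\<phi>\<close>. The bound sums all iterates because the process may stop at any round and
  monotonicity of \<open>\<phi>\<close> alone does not order them.\<close>

lemma regular_refinement_in_bounding_family:
  assumes r: "built r \<S>" and bounds: "bounds_with_rate X \<S> \<Phi> \<phi>"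
    and L: "finite \<L>" "\<L> \<subseteq> \<A>" and "0 < \<epsilon>"
    and "\<P> \<in> \<Phi>" "card \<P> \<le> m"
    and "real (card \<L>) < (\<Sum>A\<in>\<L>. energy \<mu> A \<P>) + real n * \<epsilon> ^ 4"
  shows "\<exists>\<Q>\<in>\<Phi>. \<Q> \<succ> \<P> \<and> (\<forall>A\<in>\<L>. regular_in_partition \<mu> \<S> \<epsilon> A \<Q>) \<and>
    card \<Q> \<le> (\<Sum>i\<le>n. ((\<lambda>k. \<phi> ((r + 1) * k)) ^^ i) m)"
  using assms(6-)
proof (induction n arbitrary: \<P> m)
  case 0
  \<comment> \<open>With no rounds left the hypothesis contradicts the maximal total energy.\<close>
  have "(\<Sum>A\<in>\<L>. energy \<mu> A \<P>) \<le> (\<Sum>A\<in>\<L>. 1)"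
    using 0 L bounds finite_partitions_measurable
    by (intro sum_mono energy_le_1) (auto simp: bounds_with_rate_def)
  with 0 show ?case by simp
next
  case (Suc n)
  let ?g = "\<lambda>k. \<phi> ((r + 1) * k)"
  \<comment> \<open>The term \<open>m\<close> covers stopping now; the remaining sum is the bound of
    the induction hypothesis started at \<open>?g m\<close>.\<close>
  have shift: "(\<Sum>i\<le>Suc n. (?g ^^ i) m) = m + (\<Sum>i\<le>n. (?g ^^ i) (?g m))"
    by (simp only: sum.atMost_Suc_shift funpow_Suc_right funpow_0 o_apply)
  show ?case
  proof (cases "\<forall>A\<in>\<L>. regular_in_partition \<mu> \<S> \<epsilon> A \<P>")
    case True
    then show ?thesis using Suc.prems finer_refl shift by (intro bexI[of _ \<P>]) auto
  next
    case False
    then obtain A where A: "A \<in> \<L>" "\<not> regular_in_partition \<mu> \<S> \<epsilon> A \<P>" by blast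
    have P: "\<P> \<in> finite_partitions X \<S>" using Suc.prems bounds by (auto simp: bounds_with_rate_def)
    obtain \<R> where R: "\<R> \<in> finite_partitions X \<S>" "\<R> \<succ> \<P>" "card \<R> \<le> (r + 1) * card \<P>"
      "energy \<mu> A \<P> + \<epsilon> ^ 4 \<le> energy \<mu> A \<R>"
      using refine_irregular_partition[OF r _ P \<open>0 < \<epsilon>\<close> A(2)] A(1) L by blast
    obtain \<R>' where R': "\<R>' \<in> \<Phi>" "\<R>' \<succ> \<R>" "card \<R>' \<le> \<phi> (card \<R>)"
      using bounds R(1) unfolding bounds_with_rate_def by blast
    have R'_part: "\<R>' \<in> finite_partitions X \<S>" using R' bounds by (auto simp: bounds_with_rate_def)
    have "\<R>' \<succ> \<P>" using R'(2) R(2) by (rule finer_trans)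
    have "card \<R> \<le> (r + 1) * m"
      using R(3) Suc.prems(2) by (meson le_trans mult_le_mono2)
    then have "card \<R>' \<le> ?g m"
      using R'(3) bounds unfolding bounds_with_rate_def by (meson le_trans monoD)
    \<comment> \<open>Passing from \<open>\<R>\<close> to its refinement \<open>\<R>'\<close> in
      \<open>\<Phi>\<close> preserves the gain.\<close>
    have gain: "energy \<mu> A \<P> + \<epsilon> ^ 4 \<le> energy \<mu> A \<R>'"
      using energy_finer_mono[of A \<R> \<R>'] R R'(2) R'_part A(1) L finite_partitions_measurable
      by fastforce
    \<comment> \<open>Only the set \<open>A\<close> is known to gain; the energies of the other sets
      do not drop because \<open>\<R>'\<close> refines \<open>\<P>\<close>.\<close>
    have "(\<Sum>B\<in>\<L>. energy \<mu> B \<P>) + \<epsilon> ^ 4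
        = energy \<mu> A \<P> + \<epsilon> ^ 4 + (\<Sum>B\<in>\<L> - {A}. energy \<mu> B \<P>)"
      by (subst sum.remove[OF L(1) A(1)]) simp
    also have "\<dots> \<le> energy \<mu> A \<R>' + (\<Sum>B\<in>\<L> - {A}. energy \<mu> B \<R>')"
      using gain P R'_part \<open>\<R>' \<succ> \<P>\<close> L finite_partitions_measurable
      by (intro add_mono sum_mono energy_finer_mono) auto
    also have "\<dots> = (\<Sum>B\<in>\<L>. energy \<mu> B \<R>')"
      by (rule sum.remove[OF L(1) A(1), symmetric])
    finally have "real (card \<L>) < (\<Sum>B\<in>\<L>. energy \<mu> B \<R>') + real n * \<epsilon> ^ 4"
      using Suc.prems(3) by (simp add: algebra_simps)
    from Suc.IH[OF R'(1) \<open>card \<R>' \<le> ?g m\<close> this] obtain \<Q> where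
      "\<Q> \<in> \<Phi>" "\<Q> \<succ> \<R>'" "\<forall>A\<in>\<L>. regular_in_partition \<mu> \<S> \<epsilon> A \<Q>"
      "card \<Q> \<le> (\<Sum>i\<le>n. (?g ^^ i) (?g m))" by blast
    moreover have "\<Q> \<succ> \<P>" using \<open>\<Q> \<succ> \<R>'\<close> \<open>\<R>' \<succ> \<P>\<close> by (rule finer_trans)
    ultimately show ?thesis unfolding shift by (intro bexI[of _ \<Q>]) auto
  qed
qed

end

section \<open>Choice of the bound and conclusion\<close>

theorem theorem2p1:
  fixes X :: "'a set" and \<A> :: "'a set set" and \<mu> :: "'a set \<Rightarrow> real"
    and \<S> :: "'a set set" and \<Phi> :: "'a set set set" and \<phi> :: "nat \<Rightarrow> nat"
  assumes "SR_system X \<A> \<mu> \<S>"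
    and "\<Phi> \<subseteq> finite_partitions X \<S>"
    and "bounds_with_rate X \<S> \<Phi> \<phi>"
  shows "\<exists>q :: real \<Rightarrow> nat \<Rightarrow> nat \<Rightarrow> nat.
    \<forall>\<L> \<P>. \<forall>\<epsilon>::real. finite \<L> \<and> \<L> \<subseteq> \<A> \<and> \<P> \<in> finite_partitions X \<S> \<and> \<epsilon> > 0 \<longrightarrow>
      (\<exists>\<Q>\<in>\<Phi>. \<Q> \<succ> \<P> \<and>
        (\<forall>A\<in>\<L>. regular_in_partition \<mu> \<S> \<epsilon> A \<Q>) \<and>
        card \<Q> \<le> q \<epsilon> (card \<L>) (card \<P>))"
proof -
  interpret SR_system X \<A> \<mu> \<S> by fact
  obtain r where r: "built r \<S>" using boundedly_built unfolding boundedly_built_def by blast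
  \<comment> \<open>Adding 1 to the floor gives the strict inequality
    \<open>real l < real (N \<epsilon> l) * \<epsilon> ^ 4\<close>, so the iteration can start from
    any nonnegative total energy.\<close>
  define N where "N \<epsilon> l = nat \<lfloor>real l / \<epsilon> ^ 4\<rfloor> + 1" for \<epsilon> :: real and l :: nat
  \<comment> \<open>The iterates start at \<open>\<phi> p\<close> since \<open>\<P>\<close> is first
    refined to a member of \<open>\<Phi>\<close>. The SR-system and \<open>\<Phi>\<close> enter only
    through \<open>r\<close> and \<open>\<phi>\<close>.\<close>
  define q where "q \<epsilon> l p = (\<Sum>i\<le>N \<epsilon> l. ((\<lambda>k. \<phi> ((r + 1) * k)) ^^ i) (\<phi> p))" for \<epsilon> l p
  show ?thesis
  proof (intro exI[of _ q] allI impI)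
    fix \<L> \<P> and \<epsilon> :: real
    assume *: "finite \<L> \<and> \<L> \<subseteq> \<A> \<and> \<P> \<in> finite_partitions X \<S> \<and> \<epsilon> > 0"
    then obtain \<P>' where P': "\<P>' \<in> \<Phi>" "\<P>' \<succ> \<P>" "card \<P>' \<le> \<phi> (card \<P>)"
      using assms(3) unfolding bounds_with_rate_def by blast
    have "real (card \<L>) / \<epsilon> ^ 4 < real (N \<epsilon> (card \<L>))"
      unfolding N_def using * by (simp add: of_nat_nat) linarith
    then have "real (card \<L>) < real (N \<epsilon> (card \<L>)) * \<epsilon> ^ 4"
      using * by (simp add: pos_divide_less_eq)
    moreover have "0 \<le> (\<Sum>A\<in>\<L>. energy \<mu> A \<P>')"
      unfolding energy_def using P'(1) assms(2) members_measurable
      by (intro sum_nonneg set_energy_nonneg) (auto simp: finite_partitions_def)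
    ultimately have "real (card \<L>) < (\<Sum>A\<in>\<L>. energy \<mu> A \<P>') + real (N \<epsilon> (card \<L>)) * \<epsilon> ^ 4"
      by linarith
    from regular_refinement_in_bounding_family[OF r assms(3) _ _ _ P'(1,3) this] *
    obtain \<Q> where "\<Q> \<in> \<Phi>" "\<Q> \<succ> \<P>'" "\<forall>A\<in>\<L>. regular_in_partition \<mu> \<S> \<epsilon> A \<Q>"
      "card \<Q> \<le> q \<epsilon> (card \<L>) (card \<P>)"
      unfolding q_def by blast
    then show "\<exists>\<Q>\<in>\<Phi>. \<Q> \<succ> \<P> \<and> (\<forall>A\<in>\<L>. regular_in_partition \<mu> \<S> \<epsilon> A \<Q>) \<and>
        card \<Q> \<le> q \<epsilon> (card \<L>) (card \<P>)"
      using finer_trans[OF _ P'(2)] by blast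
  qed
qed

end
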